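(* Let $d\in\mathbb N$, $d\ge 1$, $\boldsymbol a\in\mathbb R^d_{>0}$, $\boldsymbol\theta\in\mathbb S^{d-1}$, and $t_1,t_2\in\mathbb R$ with $t_1<t_2$. Let $\ell:=\|\boldsymbol\theta\|_0$ be the number of non-zero entries of $\boldsymbol\theta$. Let $V_{\boldsymbol\theta}^{\boldsymbol a}(t_1,t_2)$ denote the $d$-dimensional volume of the intersection of the hypercube $(-\boldsymbol a,\boldsymbol a]$ with the slab $S_{\boldsymbol\theta}(t_1,t_2)=\{\boldsymbol x\in\mathbb R^d:\langle\boldsymbol x,\boldsymbol\theta\rangle\in[t_1,t_2]\}$. Then $$ V_{\boldsymbol\theta}^{\boldsymbol a}(t_1,t_2) =\frac{2^{d-\ell}\,P(\boldsymbol a)}{P\big((\boldsymbol a\odot\boldsymbol\theta)^\circ\big)\,\ell!} \sum_{\boldsymbol k\in\{-1,1\}^\ell}P(\boldsymbol k) \Big(\big(t_2+\langle\boldsymbol k,(\boldsymbol a\odot\boldsymbol\theta)^\circ\rangle\big)_+^{\ell} -\big(t_1+\langle\boldsymbol k,(\boldsymbol a\odot\boldsymbol\theta)^\circ\rangle\big)_+^{\ell}\Big). $$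
   Context: $\mathbb S^{d-1}=\{\boldsymbol x\in\mathbb R^d:\|\boldsymbol x\|=1\}$ is the Euclidean unit sphere. For $\boldsymbol a\in\mathbb R^d_{>0}$, $(-\boldsymbol a,\boldsymbol a]=\prod_{i=1}^d(-a_i,a_i]$. Notation: $\boldsymbol x\odot\boldsymbol y$ is the componentwise product. $P(\boldsymbol x)=\prod_j x_j$ is the product of all entries of a vector. $\boldsymbol x^\circ\in\mathbb R^{\|\boldsymbol x\|_0}$ is the vector of the non-zero entries of $\boldsymbol x$ in their original order, where $\|\boldsymbol x\|_0$ is the number of non-zero entries. $(x)_+=x$ if $x>0$ and $(x)_+=0$ if $x\le 0$, and $(x)_+^m$ denotes its $m$-th power. *)

theory Defs
  imports "HOL-Analysis.Analysis"
begin

text \<open>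
  The index type of a vector is a linearly ordered finite type (for instance the numeral type
  of cardinality \<open>d\<close>), so that ``original order'' of the entries makes sense. A vector whose
  dimension depends on another vector is a list. The componentwise product of two
  vectors is the library's multiplication on \<open>real ^ 'n\<close>.
\<close>

definition l0_norm :: "real ^ 'n \<Rightarrow> nat" where
  "l0_norm x = card {i. x $ i \<noteq> 0}"

definition nonzero_entries :: "real ^ 'n::{finite,linorder} \<Rightarrow> real list" where
  "nonzero_entries x = filter (\<lambda>y. y \<noteq> 0) (map (\<lambda>i. x $ i) (sorted_list_of_set UNIV))"

lemma length_nonzero_entries: "length (nonzero_entries x) = l0_norm x"
proof -
  have "length (nonzero_entries x) =
      length (filter (\<lambda>i. x $ i \<noteq> 0) (sorted_list_of_set UNIV))"
    by (simp add: nonzero_entries_def filter_map comp_def)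
  also have "\<dots> = card (set (filter (\<lambda>i. x $ i \<noteq> 0) (sorted_list_of_set UNIV)))"
    by (rule distinct_card[symmetric]) simp
  also have "\<dots> = l0_norm x"
    by (simp add: l0_norm_def)
  finally show ?thesis .
qed

definition vec_prod :: "real ^ 'n \<Rightarrow> real" where
  "vec_prod x = (\<Prod>i\<in>UNIV. x $ i)"

text \<open>Only used for lists of equal length.\<close>

definition list_inner :: "real list \<Rightarrow> real list \<Rightarrow> real" where
  "list_inner x y = (\<Sum>i<length x. x ! i * y ! i)"

definition sign_vectors :: "nat \<Rightarrow> real list set" where
  "sign_vectors m = {k. length k = m \<and> set k \<subseteq> {-1, 1}}"

lemma finite_sign_vectors: "finite (sign_vectors m)"
  using finite_lists_length_eq[of "{-1, 1 :: real}" m]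
  by (simp add: sign_vectors_def conj_commute)

definition pos_part :: "real \<Rightarrow> real" where
  "pos_part x = (if x > 0 then x else 0)"

definition hypercube :: "real ^ 'n \<Rightarrow> (real ^ 'n) set" where
  "hypercube a = {x. \<forall>i. - (a $ i) < x $ i \<and> x $ i \<le> a $ i}"

definition slab :: "real ^ 'n \<Rightarrow> real \<Rightarrow> real \<Rightarrow> (real ^ 'n) set" where
  "slab \<theta> t1 t2 = {x. x \<bullet> \<theta> \<in> {t1..t2}}"

definition slab_volume :: "real ^ 'n \<Rightarrow> real ^ 'n \<Rightarrow> real \<Rightarrow> real \<Rightarrow> real" where
  "slab_volume a \<theta> t1 t2 = measure lebesgue (hypercube a \<inter> slab \<theta> t1 t2)"

end

theory Submission
  imports Defs
begin

text \<open>
  Let \<open>F(t)\<close> be the volume of the part of the box in the half-space \<open>\<langle>x, \<theta>\<rangle> \<le> t\<close>. By Fubini, adding a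
  coordinate with half-width \<open>a\<close> and weight \<open>c\<close> replaces \<open>F(t)\<close> by the integral of \<open>F(t - c y)\<close> over
  \<open>y \<in> [-a, a]\<close>. If \<open>c = 0\<close> this is a factor \<open>2 a\<close>; otherwise it raises the degree of the truncated
  power by one, divides by \<open>c\<close> and takes the difference of the values at \<open>t + a c\<close> and
  \<open>t - a c\<close>, which accounts for one more sign in the sum. The slab is the difference of two half-spaces
  up to a null hyperplane.
\<close>

section \<open>Truncated powers, their alternating sums and their integrals\<close>

text \<open>
  For \<open>n = 0\<close> this is the Heaviside function, which starts the induction, whereas \<open>pos_part s ^ 0 = 1\<close>
  for every \<open>s\<close>.
\<close>

definition trunc_pow :: "nat \<Rightarrow> real \<Rightarrow> real" where
  "trunc_pow n s = (if s \<ge> 0 then s ^ n / fact n else 0)"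

text \<open>An iterated central difference of \<open>trunc_pow n\<close>, with one step size per
  entry of \<open>bs\<close>. The degree \<open>n\<close> is kept independent of the length of
  \<open>bs\<close>, so that the integration rule can be proved by induction on \<open>bs\<close> at
  a fixed degree.\<close>

definition sign_sum :: "nat \<Rightarrow> real list \<Rightarrow> real \<Rightarrow> real" where
  "sign_sum n bs t = (\<Sum>k\<in>sign_vectors (length bs). prod_list k * trunc_pow n (t + list_inner k bs))"

lemma trunc_pow_eq_pos_part: "n > 0 \<Longrightarrow> trunc_pow n s = pos_part s ^ n / fact n"
  by (auto simp: trunc_pow_def pos_part_def)

lemma sign_vectors_0 [simp]: "sign_vectors 0 = {[]}"
  by (auto simp: sign_vectors_def)

lemma sign_vectors_Suc:
  "sign_vectors (Suc m) = Cons 1 ` sign_vectors m \<union> Cons (-1) ` sign_vectors m"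
proof (rule set_eqI)
  fix k :: "real list"
  show "k \<in> sign_vectors (Suc m) \<longleftrightarrow> k \<in> Cons 1 ` sign_vectors m \<union> Cons (-1) ` sign_vectors m"
    by (cases k) (auto simp: sign_vectors_def)
qed

lemma list_inner_Nil [simp]: "list_inner [] y = 0"
  by (simp add: list_inner_def)

lemma list_inner_Cons [simp]: "list_inner (x # xs) (y # ys) = x * y + list_inner xs ys"
  by (simp add: list_inner_def sum.lessThan_Suc_shift del: sum.lessThan_Suc)

lemma sign_sum_Nil [simp]: "sign_sum n [] t = trunc_pow n t"
  by (simp add: sign_sum_def)

lemma sign_sum_Cons:
  "sign_sum n (b # bs) t = sign_sum n bs (t + b) - sign_sum n bs (t - b)"
proof -
  have "sign_sum n (b # bs) t =
      (\<Sum>k\<in>Cons 1 ` sign_vectors (length bs). prod_list k * trunc_pow n (t + list_inner k (b # bs)))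
    + (\<Sum>k\<in>Cons (-1) ` sign_vectors (length bs). prod_list k * trunc_pow n (t + list_inner k (b # bs)))"
    unfolding sign_sum_def length_Cons sign_vectors_Suc
    by (rule sum.union_disjoint) (auto simp: finite_sign_vectors)
  then show ?thesis
    by (simp add: sum.reindex sign_sum_def sum_negf add.assoc [symmetric] diff_add_eq add_diff_eq)
qed

lemma isCont_trunc_pow_Suc: "isCont (trunc_pow (Suc n)) s"
proof -
  have "trunc_pow (Suc n) = (\<lambda>s. max 0 s ^ Suc n / fact (Suc n))"
    by (auto simp: trunc_pow_def max_def)
  then show ?thesis
    by (auto intro!: continuous_intros)
qed

text \<open>The point 0 is excluded because for \<open>n = 0\<close> the antiderivative
  \<open>trunc_pow 1\<close> has a kink there.\<close>

lemma trunc_pow_Suc_has_derivative: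
  assumes "s \<noteq> 0"
  shows "(trunc_pow (Suc n) has_real_derivative trunc_pow n s) (at s)"
proof (cases "s > 0")
  case True
  have "((\<lambda>s. s ^ Suc n / fact (Suc n)) has_real_derivative s ^ n / fact n) (at s)"
    using DERIV_cdivide [OF DERIV_pow [of "Suc n" s], of "fact (Suc n)"]
    by (simp add: fact_Suc [where 'a = real] del: of_nat_Suc)
  then have "(trunc_pow (Suc n) has_real_derivative s ^ n / fact n) (at s)"
    by (rule has_field_derivative_transform_within_open [where S = "{0<..}"])
      (use True in \<open>auto simp: trunc_pow_def\<close>)
  with True show ?thesis
    by (simp add: trunc_pow_def)
next
  case False
  have "((\<lambda>s. 0) has_real_derivative 0) (at s)"
    by simp
  then have "(trunc_pow (Suc n) has_real_derivative 0) (at s)"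
    by (rule has_field_derivative_transform_within_open [where S = "{..<0}"])
      (use False assms in \<open>auto simp: trunc_pow_def\<close>)
  with False assms show ?thesis
    by (simp add: trunc_pow_def)
qed

lemma trunc_pow_has_integral:
  fixes a c t :: real
  assumes "a > 0" "c \<noteq> 0"
  shows "((\<lambda>y. trunc_pow n (t - c * y)) has_integral
    (trunc_pow (Suc n) (t + a * c) - trunc_pow (Suc n) (t - a * c)) / c) {-a..a}"
proof -
  let ?F = "\<lambda>y. - trunc_pow (Suc n) (t - c * y) / c"
  have "((\<lambda>y. trunc_pow n (t - c * y)) has_integral ?F a - ?F (-a)) {-a..a}"
  \<comment> \<open>At \<open>t / c\<close> the argument \<open>t - c * y\<close> vanishes. The
    antiderivative need only be continuous at this one point.\<close>
  proof (rule fundamental_theorem_of_calculus_interior_strong [where S = "{t / c}"])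
    show "continuous_on {- a..a} ?F"
      by (intro continuous_at_imp_continuous_on ballI continuous_intros
          isCont_o2 [OF _ isCont_trunc_pow_Suc] assms)
    fix y assume y: "y \<in> {- a<..<a} - {t / c}"
    then have "t - c * y \<noteq> 0"
      using assms by (auto simp: field_simps)
    then have "(?F has_real_derivative trunc_pow n (t - c * y)) (at y)"
      using assms
      by (auto intro!: derivative_eq_intros DERIV_chain2 [OF trunc_pow_Suc_has_derivative])
    then show "(?F has_vector_derivative trunc_pow n (t - c * y)) (at y)"
      by (simp add: has_real_derivative_iff_has_vector_derivative)
  qed (use assms in auto)
  then show ?thesis
    by (simp add: diff_divide_distrib mult.commute)
qed

text \<open>Integration is linear and commutes with translations in \<open>t\<close>, hence with the
  central differences that build \<open>sign_sum\<close>. This reduces the claim to a single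
  truncated power.\<close>

lemma sign_sum_has_integral:
  fixes a c t :: real
  assumes "a > 0" "c \<noteq> 0"
  shows "((\<lambda>y. sign_sum n bs (t - c * y)) has_integral sign_sum (Suc n) (a * c # bs) t / c) {-a..a}"
proof (induction bs arbitrary: t)
  case Nil
  then show ?case
    using trunc_pow_has_integral [OF assms] by (simp add: sign_sum_Cons)
next
  case (Cons b bs)
  have "((\<lambda>y. sign_sum n bs ((t + b) - c * y) - sign_sum n bs ((t - b) - c * y)) has_integral
      sign_sum (Suc n) (a * c # bs) (t + b) / c - sign_sum (Suc n) (a * c # bs) (t - b) / c) {-a..a}"
    by (intro has_integral_diff Cons.IH)
  \<comment> \<open>The central differences with steps \<open>a * c\<close> and \<open>b\<close>
    commute: both sides unfold to the same four values at t \<plusminus> b \<plusminus> a c.\<close>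
  then show ?case
    by (simp add: sign_sum_Cons algebra_simps diff_divide_distrib add_divide_distrib)
qed

section \<open>Volume of a box cut by a half-space, one coordinate at a time\<close>

definition box_halfspace :: "'i set \<Rightarrow> ('i \<Rightarrow> real) \<Rightarrow> ('i \<Rightarrow> real) \<Rightarrow> real \<Rightarrow> ('i \<Rightarrow> real) set" where
  "box_halfspace I a c t =
    {x \<in> I \<rightarrow>\<^sub>E UNIV. (\<forall>i\<in>I. - a i < x i \<and> x i \<le> a i) \<and> (\<Sum>i\<in>I. x i * c i) \<le> t}"

text \<open>The closed formula, not the measure itself; \<open>emeasure_box_halfspace\<close> shows
  that the two agree. The coordinates form a list, which gives both the recursion and the order of
  the non-zero entries.\<close>

definition box_halfspace_volume :: "'i list \<Rightarrow> ('i \<Rightarrow> real) \<Rightarrow> ('i \<Rightarrow> real) \<Rightarrow> real \<Rightarrow> real" where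
  "box_halfspace_volume js a c t =
    (let bs = filter (\<lambda>b. b \<noteq> 0) (map (\<lambda>i. a i * c i) js)
     in 2 ^ (length js - length bs) * prod_list (map a js) / prod_list bs * sign_sum (length bs) bs t)"

lemma sets_box_halfspace:
  assumes "finite I"
  shows "box_halfspace I a c t \<in> sets (PiM I (\<lambda>_. lborel))"
proof -
  have "box_halfspace I a c t = {x \<in> space (PiM I (\<lambda>_. lborel)).
      (\<forall>i\<in>I. - a i < x i \<and> x i \<le> a i) \<and> (\<Sum>i\<in>I. x i * c i) \<le> t}"
    by (simp add: box_halfspace_def space_PiM)
  also have "\<dots> \<in> sets (PiM I (\<lambda>_. lborel))"
    using assms by measurable
  finally show ?thesis .
qed

text \<open>The closed formula obeys the recursion that Fubini gives for the volume.\<close>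

lemma box_halfspace_volume_has_integral:
  assumes "a i > 0"
  shows "((\<lambda>y. box_halfspace_volume js a c (t - c i * y)) has_integral
    box_halfspace_volume (i # js) a c t) {- a i..a i}"
proof -
  define bs where "bs = filter (\<lambda>b. b \<noteq> 0) (map (\<lambda>i. a i * c i) js)"
  define C where "C = 2 ^ (length js - length bs) * prod_list (map a js) / prod_list bs"
  have eq: "box_halfspace_volume js a c s = C * sign_sum (length bs) bs s" for s
    by (simp add: box_halfspace_volume_def Let_def bs_def C_def)
  have len: "length bs \<le> length js"
    unfolding bs_def by (metis length_filter_le length_map)
  show ?thesis
  proof (cases "c i = 0")
    case True
    \<comment> \<open>The list \<open>bs\<close> is unchanged, so the exponent of 2 grows by one;
      \<open>len\<close> keeps the subtraction of naturals from being cut off.\<close>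
    then have "box_halfspace_volume (i # js) a c t = 2 * a i * box_halfspace_volume js a c t"
      using len by (simp add: box_halfspace_volume_def Let_def flip: bs_def) (simp add: Suc_diff_le)
    moreover have "((\<lambda>y. box_halfspace_volume js a c t) has_integral
        2 * a i * box_halfspace_volume js a c t) {- a i..a i}"
      using has_integral_const_real [of "box_halfspace_volume js a c t" "- a i" "a i"] assms by simp
    ultimately show ?thesis
      using True by simp
  next
    case False
    \<comment> \<open>Both lists grow by one, so the power of 2 stays. The new \<open>a i\<close> in
      the numerator cancels against \<open>a i * c i\<close> in the denominator and leaves
      \<open>1 / c i\<close>.\<close>
    then have "box_halfspace_volume (i # js) a c t =
        C * (sign_sum (Suc (length bs)) (a i * c i # bs) t / c i)"
      using assms by (simp add: box_halfspace_volume_def Let_def C_def mult.commute [of "c i"] flip: bs_def)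
    then show ?thesis
      unfolding eq using has_integral_mult_right [OF sign_sum_has_integral [OF assms False]] by simp
  qed
qed

text \<open>Nonnegativity is carried through the induction because \<open>ennreal\<close> sends
  negative reals to 0, and because passing from the real integral to the nonnegative one requires a
  nonnegative integrand.\<close>

lemma emeasure_box_halfspace:
  assumes "distinct js" "\<And>i. i \<in> set js \<Longrightarrow> a i > 0"
  shows "emeasure (PiM (set js) (\<lambda>_. lborel)) (box_halfspace (set js) a c t) =
      ennreal (box_halfspace_volume js a c t) \<and> box_halfspace_volume js a c t \<ge> 0"
  using assms
proof (induction js arbitrary: t)
  case Nil
  \<comment> \<open>The empty product space is a single point of mass 1, and the empty sum 0
    satisfies the constraint exactly when t \<ge> 0.\<close>
  have "emeasure (PiM {} (\<lambda>_. lborel)) (box_halfspace {} a c t) = (if t \<ge> 0 then 1 else 0)"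
    by (simp add: box_halfspace_def PiM_empty)
  then show ?case
    by (simp add: box_halfspace_volume_def trunc_pow_def)
next
  case (Cons i js)
  interpret product_sigma_finite "\<lambda>_::'a. lborel :: real measure" ..
  let ?V = "\<lambda>y. box_halfspace_volume js a c (t - c i * y)"
  have a: "a i > 0" and i: "i \<notin> set js"
    using Cons.prems by auto
  have IH: "emeasure (PiM (set js) (\<lambda>_. lborel)) (box_halfspace (set js) a c s) =
      ennreal (box_halfspace_volume js a c s)" "box_halfspace_volume js a c s \<ge> 0" for s
    using Cons by simp_all
  note int = box_halfspace_volume_has_integral [of a i js c t, OF a]
  \<comment> \<open>For a fixed value \<open>y\<close> of the new coordinate, its contribution to
    the inner product moves to the right-hand side of the half-space inequality.\<close>
  have ind: "indicator (box_halfspace (insert i (set js)) a c t) (x(i := y)) =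
      indicator {- a i<..a i} y * (indicator (box_halfspace (set js) a c (t - c i * y)) x :: ennreal)"
    if "x \<in> space (PiM (set js) (\<lambda>_. lborel))" for x y
  proof -
    have "(\<Sum>j\<in>set js. (x(i := y)) j * c j) = (\<Sum>j\<in>set js. x j * c j)"
      using i by (intro sum.cong) auto
    moreover have "(\<forall>j\<in>set js. - a j < (x(i := y)) j \<and> (x(i := y)) j \<le> a j) \<longleftrightarrow>
        (\<forall>j\<in>set js. - a j < x j \<and> x j \<le> a j)"
      using i by (intro ball_cong) auto
    moreover have "x \<in> set js \<rightarrow>\<^sub>E UNIV"
      using that by (simp add: space_PiM)
    moreover from this have "x(i := y) \<in> insert i (set js) \<rightarrow>\<^sub>E UNIV"
      by (auto simp: PiE_def extensional_def)
    ultimately show ?thesis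
      using i by (auto simp: box_halfspace_def indicator_def algebra_simps fun_upd_same
          simp del: fun_upd_apply)
  qed
  have "emeasure (PiM (insert i (set js)) (\<lambda>_. lborel)) (box_halfspace (insert i (set js)) a c t) =
      (\<integral>\<^sup>+ x. indicator (box_halfspace (insert i (set js)) a c t) x \<partial>PiM (insert i (set js)) (\<lambda>_. lborel))"
    by (subst nn_integral_indicator) (auto intro: sets_box_halfspace)
  also have "\<dots> = (\<integral>\<^sup>+ y. (\<integral>\<^sup>+ x. indicator (box_halfspace (insert i (set js)) a c t) (x(i := y))
      \<partial>PiM (set js) (\<lambda>_. lborel)) \<partial>lborel)"
    by (intro product_nn_integral_insert_rev borel_measurable_indicator) (auto intro!: i sets_box_halfspace)
  also have "\<dots> = (\<integral>\<^sup>+ y. (\<integral>\<^sup>+ x. indicator {- a i<..a i} y *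
      indicator (box_halfspace (set js) a c (t - c i * y)) x \<partial>PiM (set js) (\<lambda>_. lborel)) \<partial>lborel)"
    by (intro nn_integral_cong ind)
  also have "\<dots> = (\<integral>\<^sup>+ y. indicator {- a i<..a i} y * ennreal (?V y) \<partial>lborel)"
    by (subst nn_integral_cmult)
      (auto intro!: borel_measurable_indicator sets_box_halfspace simp: IH sets_box_halfspace)
  also have "\<dots> = (\<integral>\<^sup>+ y. indicator {- a i..a i} y * ennreal (?V y) \<partial>lborel)"
  \<comment> \<open>The integral rule is stated on the closed interval; the added endpoint is a null
    set.\<close>
  proof (rule nn_integral_cong_AE)
    show "AE y in lborel. indicator {- a i<..a i} y * ennreal (?V y) =
        indicator {- a i..a i} y * ennreal (?V y)"
      using AE_lborel_singleton [of "- a i"] by eventually_elim (auto simp: indicator_def)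
  qed
  also have "\<dots> = ennreal (box_halfspace_volume (i # js) a c t)"
    using nn_integral_has_integral_lebesgue [OF IH(2) int]
    by (simp add: ennreal_mult'' IH(2) ennreal_indicator)
  finally show ?case
    using has_integral_nonneg [OF int] IH(2) by simp
qed

section \<open>Transfer to vectors and the slab\<close>

lemma mem_hypercube_iff_Basis:
  "x \<in> hypercube a \<longleftrightarrow> (\<forall>b\<in>Basis. - (a \<bullet> b) < x \<bullet> b \<and> x \<bullet> b \<le> a \<bullet> b)"
  by (auto simp: hypercube_def Basis_vec_def inner_axis)

lemma hypercube_borel [measurable]: "hypercube a \<in> sets borel"
proof -
  have "hypercube a = {x. \<forall>b\<in>Basis. - (a \<bullet> b) < x \<bullet> b \<and> x \<bullet> b \<le> a \<bullet> b}"
    by (auto simp: mem_hypercube_iff_Basis)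
  then show ?thesis
    by simp
qed

text \<open>By \<open>lborel_eq\<close>, Lebesgue measure is the image of the product measure
  indexed by \<open>Basis\<close> under the map from coefficients to vectors, so the basis vectors
  themselves serve as coordinate indices.\<close>

lemma emeasure_hypercube_halfspace:
  fixes a \<theta> :: "real ^ 'n::finite"
  shows "emeasure lborel (hypercube a \<inter> {x. x \<bullet> \<theta> \<le> t}) =
    emeasure (PiM (Basis :: (real ^ 'n) set) (\<lambda>_. lborel)) (box_halfspace Basis ((\<bullet>) a) ((\<bullet>) \<theta>) t)"
proof -
  let ?h = "\<lambda>f. \<Sum>b\<in>(Basis :: (real ^ 'n) set). f b *\<^sub>R b"
  let ?M = "PiM (Basis :: (real ^ 'n) set) (\<lambda>_. lborel :: real measure)"
  have "emeasure lborel (hypercube a \<inter> {x. x \<bullet> \<theta> \<le> t}) =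
      emeasure ?M (?h -` (hypercube a \<inter> {x. x \<bullet> \<theta> \<le> t}) \<inter> space ?M)"
    by (subst lborel_eq, rule emeasure_distr) measurable
  also have "?h -` (hypercube a \<inter> {x. x \<bullet> \<theta> \<le> t}) \<inter> space ?M = box_halfspace Basis ((\<bullet>) a) ((\<bullet>) \<theta>) t"
    by (auto simp: box_halfspace_def mem_hypercube_iff_Basis space_PiM inner_sum_left_Basis
        euclidean_inner [of _ \<theta>])
  finally show ?thesis .
qed

lemma hypercube_halfspace_volume:
  fixes a \<theta> :: "real ^ 'n::{finite,linorder}"
  assumes a_pos: "\<And>i. a $ i > 0" and \<theta>: "\<theta> \<noteq> 0" and l: "l = l0_norm \<theta>"
  defines "bs \<equiv> nonzero_entries (a * \<theta>)"
  defines "V \<equiv> \<lambda>t. 2 ^ (CARD('n) - l) * vec_prod a / (prod_list bs * fact l) *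
    (\<Sum>k\<in>sign_vectors l. prod_list k * pos_part (t + list_inner k bs) ^ l)"
  shows "emeasure lborel (hypercube a \<inter> {x. x \<bullet> \<theta> \<le> t}) = ennreal (V t) \<and> V t \<ge> 0"
proof -
  let ?ns = "sorted_list_of_set (UNIV :: 'n set)"
  \<comment> \<open>Listing the basis in the order of the index type makes the filtered list of
    products equal to \<open>nonzero_entries (a * \<theta>)\<close>.\<close>
  let ?js = "map (\<lambda>i. axis i 1 :: (real, 'n) vec) ?ns"
  have "set ?js = Basis"
    by (auto simp: Basis_vec_def)
  moreover have "distinct ?js"
    by (simp add: distinct_map inj_on_def axis_eq_axis)
  moreover have "a \<bullet> b > 0" if "b \<in> Basis" for b
    using that a_pos by (auto simp: Basis_vec_def inner_axis)
  ultimately have *: "emeasure lborel (hypercube a \<inter> {x. x \<bullet> \<theta> \<le> t}) =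
      ennreal (box_halfspace_volume ?js ((\<bullet>) a) ((\<bullet>) \<theta>) t) \<and>
      box_halfspace_volume ?js ((\<bullet>) a) ((\<bullet>) \<theta>) t \<ge> 0"
    using emeasure_box_halfspace [of ?js "(\<bullet>) a" "(\<bullet>) \<theta>" t]
    by (simp add: emeasure_hypercube_halfspace)
  have "{i. (a * \<theta>) $ i \<noteq> 0} = {i. \<theta> $ i \<noteq> 0}"
    using a_pos by (auto simp: less_le)
  then have len: "length bs = l"
    by (simp add: bs_def length_nonzero_entries l l0_norm_def)
  \<comment> \<open>A positive degree is what allows \<open>trunc_pow l\<close> to be replaced by a
    power of \<open>pos_part\<close>.\<close>
  obtain i where "\<theta> $ i \<noteq> 0"
    using \<theta> by (auto simp: vec_eq_iff)
  then have "l > 0"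
    by (auto simp: l l0_norm_def card_gt_0_iff)
  then have sum: "sign_sum l bs t =
      (\<Sum>k\<in>sign_vectors l. prod_list k * pos_part (t + list_inner k bs) ^ l) / fact l"
    by (simp add: sign_sum_def len trunc_pow_eq_pos_part sum_divide_distrib)
  have "filter (\<lambda>b. b \<noteq> 0) (map (\<lambda>b. (a \<bullet> b) * (\<theta> \<bullet> b)) ?js) = bs"
    by (simp add: bs_def nonzero_entries_def inner_axis comp_def)
  moreover have "prod_list (map ((\<bullet>) a) ?js) = vec_prod a"
    by (simp add: vec_prod_def inner_axis comp_def flip: prod.distinct_set_conv_list)
  ultimately have "box_halfspace_volume ?js ((\<bullet>) a) ((\<bullet>) \<theta>) t = V t"
    by (simp add: box_halfspace_volume_def Let_def len sum V_def)
  with * show ?thesis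
    by simp
qed

theorem corollary6:
  fixes a \<theta> :: "real ^ 'n::{finite,linorder}" and t1 t2 :: real and l :: nat
  assumes a_pos: "\<And>i. a $ i > 0"
    and theta: "\<theta> \<in> sphere 0 1"
    and t: "t1 < t2"
    and l: "l = l0_norm \<theta>"
  shows "slab_volume a \<theta> t1 t2 =
    2 ^ (CARD('n) - l) * vec_prod a / (prod_list (nonzero_entries (a * \<theta>)) * fact l) *
    (\<Sum>k\<in>sign_vectors l. prod_list k *
      (pos_part (t2 + list_inner k (nonzero_entries (a * \<theta>))) ^ l
       - pos_part (t1 + list_inner k (nonzero_entries (a * \<theta>))) ^ l))"
proof -
  let ?H = "\<lambda>t. hypercube a \<inter> {x. x \<bullet> \<theta> \<le> t}"
  define V where "V t = 2 ^ (CARD('n) - l) * vec_prod a / (prod_list (nonzero_entries (a * \<theta>)) * fact l) *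
    (\<Sum>k\<in>sign_vectors l. prod_list k * pos_part (t + list_inner k (nonzero_entries (a * \<theta>))) ^ l)" for t
  have \<theta>: "\<theta> \<noteq> 0"
    using theta by auto
  have em: "emeasure lborel (?H s) = ennreal (V s)" "V s \<ge> 0" for s
    using hypercube_halfspace_volume [OF a_pos \<theta> l, of s] by (simp_all add: V_def)
  have H [measurable]: "?H s \<in> sets lborel" for s
    by measurable
  have fm: "?H s \<in> fmeasurable lebesgue" for s
    using H [of s] em(1) [of s] by (intro fmeasurableI) auto
  have ms: "measure lebesgue (?H s) = V s" for s
    using H [of s] em [of s] by (simp add: measure_def)
  have "slab_volume a \<theta> t1 t2 = measure lebesgue (?H t2 - ?H t1)"
    unfolding slab_volume_def
  proof (rule measure_negligible_symdiff)
    show "?H t2 - ?H t1 \<in> lmeasurable"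
      by (intro fmeasurable.Diff fm)
    \<comment> \<open>The difference of the half-spaces omits the points with inner product exactly
      \<open>t1\<close>, which the slab contains.\<close>
    have "negligible {x. \<theta> \<bullet> x = t1}"
      using \<theta> by (intro negligible_hyperplane) simp
    then show "negligible ((?H t2 - ?H t1) - hypercube a \<inter> slab \<theta> t1 t2 \<union>
        (hypercube a \<inter> slab \<theta> t1 t2 - (?H t2 - ?H t1)))"
      by (rule negligible_subset) (use t in \<open>auto simp: slab_def inner_commute\<close>)
  qed
  also have "\<dots> = V t2 - V t1"
    \<comment> \<open>Since \<open>t1 < t2\<close>, the first set lies inside the second, so the
      measures subtract.\<close>
    using t by (subst measurable_measure_Diff) (auto simp: fm ms fmeasurableD)
  also have "\<dots> = 2 ^ (CARD('n) - l) * vec_prod a / (prod_list (nonzero_entries (a * \<theta>)) * fact l) *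
    (\<Sum>k\<in>sign_vectors l. prod_list k *
      (pos_part (t2 + list_inner k (nonzero_entries (a * \<theta>))) ^ l
       - pos_part (t1 + list_inner k (nonzero_entries (a * \<theta>))) ^ l))"
    by (simp add: V_def sum_subtractf right_diff_distrib)
  finally show ?thesis .
qed

end
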